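(* Let $V\subset\mathbb R[\mathbf x]$ be a vector space connected to $1$, and let $\sigma$ be a linear form on $\langle V\cdot V\rangle$. Let $U\subset V$ be a subspace with $1\in U$ and $U^+\subset V$. Suppose that $\operatorname{rank}H^{V,V}_\sigma=\operatorname{rank}H^{U,U}_\sigma=r$ and that $\langle\sigma\mid p^2\rangle\ge0$ for all $p\in V$. Then there is a unique $\tilde\sigma\in\mathbb R[[\mathbf y]]$ which coincides with $\sigma$ on $\langle V\cdot V\rangle$ and satisfies $\operatorname{rank}H_{\tilde\sigma}=r$. It is of the form $$\tilde\sigma=\sum_{i=1}^r\omega_i\,\mathbf e_{\xi_i}(\mathbf y)$$ with $\omega_i>0$ and $\xi_i\in\mathbb R^n$.
   Context: $\mathbb R[[\mathbf y]]$ is identified with the dual of $\mathbb R[\mathbf x]$ via $\langle\mathbf y^\alpha\mid\mathbf x^\beta\rangle=\alpha!\,\delta_{\alpha\beta}$. $H_\sigma:p\mapsto p\star\sigma$ with $\langle p\star\sigma\mid q\rangle=\langle\sigma\mid pq\rangle$. $\mathbf e_\xi(\mathbf y)=\exp(\sum_j\xi_jy_j)$. $V^+=V+x_1V+\dots+x_nV$. The space $V$ is connected to $1$ if there is a finite chain $\langle1\rangle=V_0\subset V_1\subset\dots\subset V_s=V$ with $V_{l+1}\subset V_l^+$. $\langle V\cdot V\rangle$ is the span of the products of pairs of elements of $V$. For $W\subset V$, $H^{W,W}_\sigma:W\to W^*$ is $p\mapsto(w\mapsto\langle\sigma\mid pw\rangle)$. *)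

theory Defs
  imports "HOL-Analysis.Analysis" "HOL-Library.Poly_Mapping" "HOL-Analysis.Finite_Function_Topology" "HOL-Library.Function_Algebras"
begin

(* Real polynomials in the variables x_j, j :: 'n (a finite type, so n = CARD('n)).
   Monomials x^alpha are indexed by exponent vectors alpha :: 'n =>0 nat.
   The real vector space structure is the one of poly_mapping (Finite_Function_Topology). *)
type_synonym 'n rpoly = "('n \<Rightarrow>\<^sub>0 nat) \<Rightarrow>\<^sub>0 real"

(* Formal power series in y: coefficient functions alpha |-> coefficient of y^alpha *)
type_synonym 'n rseries = "('n \<Rightarrow>\<^sub>0 nat) \<Rightarrow> real"

definition xmonom :: "('n \<Rightarrow>\<^sub>0 nat) \<Rightarrow> 'n rpoly" where
  "xmonom \<alpha> = Poly_Mapping.single \<alpha> 1"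

definition xvar :: "'n \<Rightarrow> 'n rpoly" where
  "xvar j = xmonom (Poly_Mapping.single j 1)"

definition mfact :: "('n::finite \<Rightarrow>\<^sub>0 nat) \<Rightarrow> real" where
  "mfact \<alpha> = (\<Prod>j\<in>UNIV. fact (Poly_Mapping.lookup \<alpha> j))"

(* duality pairing <y^alpha | x^beta> = alpha! delta_{alpha beta}, extended bilinearly *)
definition pair :: "'n::finite rseries \<Rightarrow> 'n rpoly \<Rightarrow> real" where
  "pair s p = (\<Sum>\<alpha>\<in>Poly_Mapping.keys p. mfact \<alpha> * s \<alpha> * Poly_Mapping.lookup p \<alpha>)"

(* p \<star> s, characterised by <p \<star> s | q> = <s | p q> *)
definition star :: "'n::finite rpoly \<Rightarrow> 'n rseries \<Rightarrow> 'n rseries" where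
  "star p s = (\<lambda>\<alpha>. pair s (p * xmonom \<alpha>) / mfact \<alpha>)"

(* e_xi(y) = exp(sum_j xi_j y_j); its coefficient of y^alpha is xi^alpha / alpha! *)
definition expser :: "('n::finite \<Rightarrow> real) \<Rightarrow> 'n rseries" where
  "expser \<xi> = (\<lambda>\<alpha>. (\<Prod>j\<in>UNIV. \<xi> j ^ Poly_Mapping.lookup \<alpha> j) / mfact \<alpha>)"

definition vplus :: "'n::finite rpoly set \<Rightarrow> 'n rpoly set" where
  "vplus V = {v + (\<Sum>j\<in>UNIV. xvar j * w j) | v w. v \<in> V \<and> (\<forall>j. w j \<in> V)}"

definition connected_to_one :: "'n::finite rpoly set \<Rightarrow> bool" where
  "connected_to_one V \<longleftrightarrow> (\<exists>(s::nat) (Vs :: nat \<Rightarrow> 'n rpoly set).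
      Vs 0 = span {1} \<and> Vs s = V \<and> (\<forall>l\<le>s. subspace (Vs l)) \<and>
      (\<forall>l<s. Vs l \<subseteq> Vs (Suc l) \<and> Vs (Suc l) \<subseteq> vplus (Vs l)))"

definition prodspan :: "'n::finite rpoly set \<Rightarrow> 'n rpoly set" where
  "prodspan V = span {p * q | p q. p \<in> V \<and> q \<in> V}"

definition fscale :: "real \<Rightarrow> ('a \<Rightarrow> real) \<Rightarrow> ('a \<Rightarrow> real)" where
  "fscale c f = (\<lambda>x. c * f x)"

definition has_dim :: "('a \<Rightarrow> real) set \<Rightarrow> nat \<Rightarrow> bool" where
  "has_dim S r \<longleftrightarrow> (\<exists>B. finite B \<and> card B = r \<and> \<not> module.dependent fscale B
                         \<and> module.span fscale B = S)"

(* H^{W,W}_sigma : W -> W^*, p |-> (w |-> <sigma | p w>); elements of W^* are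
   represented as functions on polynomials vanishing outside W *)
definition HWW :: "('n::finite rpoly \<Rightarrow> real) \<Rightarrow> 'n rpoly set \<Rightarrow> 'n rpoly \<Rightarrow> ('n rpoly \<Rightarrow> real)" where
  "HWW \<sigma> W p = (\<lambda>w. if w \<in> W then \<sigma> (p * w) else 0)"

definition rankHWW_eq :: "('n::finite rpoly \<Rightarrow> real) \<Rightarrow> 'n rpoly set \<Rightarrow> nat \<Rightarrow> bool" where
  "rankHWW_eq \<sigma> W r \<longleftrightarrow> has_dim (HWW \<sigma> W ` W) r"

definition rankH_eq :: "'n::finite rseries \<Rightarrow> nat \<Rightarrow> bool" where
  "rankH_eq s r \<longleftrightarrow> has_dim (range (\<lambda>p. star p s)) r"

end

theory Submission
  imports Defs "HOL-Computational_Algebra.Fundamental_Theorem_Algebra"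
begin

text \<open>
  Let \<open>K\<close> be the kernel of the form \<open>(p, q) \<mapsto> \<sigma> (p q)\<close> on \<open>V\<close>. Equality of the two ranks gives
  \<open>V = U + K\<close>; choose a projection \<open>N\<close> of \<open>V\<close> along \<open>K\<close> into \<open>U\<close>. The operators
  \<open>u \<mapsto> N (x\<^sub>j u)\<close> are symmetric and commute, so they define a linear map \<open>\<phi>\<close> with
  \<open>\<phi> (x\<^sub>j p) = N (x\<^sub>j \<phi> p)\<close>, and \<open>p \<mapsto> \<sigma> (\<phi> p)\<close> is the extension; connectedness to \<open>1\<close> yields
  \<open>\<phi> = N\<close> on \<open>V\<close>. Uniqueness holds because the annihilator of any extension of rank \<open>r\<close>
  contains \<open>K\<close>, so modulo the annihilators every polynomial reduces to an element of \<open>U\<close>.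

  Such an extension \<open>s\<close> is again positive. Instead of diagonalising the multiplication operators,
  note that positivity makes the annihilator a real radical ideal: each variable \<open>x\<^sub>j\<close> is
  annihilated modulo it by a product of distinct real linear factors. Products of Lagrange
  polynomials then give orthogonal idempotents \<open>L\<^sub>\<xi>\<close> with \<open>p L\<^sub>\<xi> = p(\<xi>) L\<^sub>\<xi>\<close> modulo the
  annihilator, whence \<open>\<langle>s | p\<rangle> = \<Sum>\<^sub>\<xi> p(\<xi>) \<langle>s | L\<^sub>\<xi>\<rangle>\<close> with
  \<open>\<langle>s | L\<^sub>\<xi>\<rangle> = \<langle>s | L\<^sub>\<xi>\<^sup>2\<rangle> \<ge> 0\<close>, and the rank counts the nonzero weights.
\<close>

section \<open>Dimension of spaces of real functions\<close>

interpretation fs: vector_space "fscale :: real \<Rightarrow> ('a \<Rightarrow> real) \<Rightarrow> 'a \<Rightarrow> real"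
  by unfold_locales (auto simp: fscale_def fun_eq_iff algebra_simps)

interpretation fsp: vector_space_pair
  "fscale :: real \<Rightarrow> ('a \<Rightarrow> real) \<Rightarrow> 'a \<Rightarrow> real" "fscale :: real \<Rightarrow> ('b \<Rightarrow> real) \<Rightarrow> 'b \<Rightarrow> real" ..

lemma fscale_apply [simp]: "fscale c f x = c * f x"
  by (simp add: fscale_def)

lemma sum_fun_apply: "(\<Sum>i\<in>I. f i :: 'a \<Rightarrow> real) x = (\<Sum>i\<in>I. f i x)"
  by (induction I rule: infinite_finite_induct) auto

lemma fs_linearI:
  assumes "\<And>f g. F (f + g) = F f + F g" and "\<And>c f. F (fscale c f) = fscale c (F f)"
  shows "Vector_Spaces.linear fscale fscale (F :: ('a \<Rightarrow> real) \<Rightarrow> 'b \<Rightarrow> real)"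
  using assms by unfold_locales auto

lemma has_dim_unique: "has_dim S m \<Longrightarrow> has_dim S n \<Longrightarrow> m = n"
  unfolding has_dim_def by (metis fs.dim_span_eq_card_independent)

lemma has_dim_lift_basis:
  assumes F: "Vector_Spaces.linear fscale fscale (F :: ('a \<Rightarrow> real) \<Rightarrow> 'b \<Rightarrow> real)"
    and "has_dim (F ` S) r"
  obtains C where "C \<subseteq> S" "finite C" "card C = r" "\<not> fs.dependent C" "F ` fs.span C = F ` S"
proof -
  obtain B where B: "finite B" "card B = r" "\<not> fs.dependent B" "fs.span B = F ` S"
    using assms(2) unfolding has_dim_def by blast
  have "B \<subseteq> F ` S" unfolding B(4)[symmetric] by (rule fs.span_superset)
  then obtain C where C: "C \<subseteq> S" "inj_on F C" "F ` C = B"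
    unfolding subset_image_inj by auto
  have "finite C" using finite_imageD[OF _ C(2)] C(3) B(1) by simp
  moreover have "card C = r" using card_image[OF C(2)] C(3) B(2) by simp
  moreover have "\<not> fs.dependent C"
  proof
    assume "fs.dependent C"
    then obtain u f where u: "f \<in> C" "u f \<noteq> 0" "(\<Sum>v\<in>C. fscale (u v) v) = 0"
      using fs.dependent_finite[OF \<open>finite C\<close>] by auto
    have "(\<Sum>w\<in>B. fscale (u (the_inv_into C F w)) w) = (\<Sum>v\<in>C. fscale (u v) (F v))"
      unfolding C(3)[symmetric] by (simp add: sum.reindex[OF C(2)] the_inv_into_f_f[OF C(2)])
    also have "\<dots> = F (\<Sum>v\<in>C. fscale (u v) v)"
      by (simp add: fsp.linear_sum[OF F] fsp.linear_scale[OF F])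
    also have "\<dots> = 0" using u(3) fsp.linear_0[OF F] by simp
    finally have "u (the_inv_into C F (F f)) = 0"
      using B(1,3) C(3) u(1) fs.independentD[of B B "\<lambda>w. u (the_inv_into C F w)"] by blast
    then show False using u(1,2) the_inv_into_f_f[OF C(2)] by simp
  qed
  moreover have "F ` fs.span C = F ` S"
    using fsp.linear_span_image[OF F, of C] C(3) B(4) by simp
  ultimately show ?thesis using C(1) that by blast
qed

lemma has_dim_image_imp_eq:
  assumes F: "Vector_Spaces.linear fscale fscale (F :: ('a \<Rightarrow> real) \<Rightarrow> 'b \<Rightarrow> real)"
    and S: "fs.subspace S" "S \<subseteq> T" and "has_dim T r" "has_dim (F ` S) r"
  shows "S = T"
proof
  obtain C where C: "C \<subseteq> S" "finite C" "card C = r" "\<not> fs.dependent C"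
    using has_dim_lift_basis[OF F assms(5)] by metis
  obtain B where B: "finite B" "card B = r" "fs.span B = T"
    using assms(4) unfolding has_dim_def by blast
  show "T \<subseteq> S"
  proof
    fix t assume t: "t \<in> T"
    have "t \<in> fs.span C"
    proof (rule ccontr)
      assume n: "t \<notin> fs.span C"
      then have "\<not> fs.dependent (insert t C)"
        using C(4) fs.independent_insertI by blast
      moreover have "insert t C \<subseteq> fs.span B" using t C(1) S(2) B(3) by blast
      ultimately have "card (insert t C) \<le> r"
        using fs.independent_span_bound[OF B(1)] B(2) by metis
      moreover have "t \<notin> C" using n fs.span_base by blast
      ultimately show False using C by simp
    qed
    then show "t \<in> S" using fs.span_minimal[OF C(1) S(1)] by blast
  qed
qed (fact S(2))

lemma has_dim_inj_image:
  assumes F: "Vector_Spaces.linear fscale fscale (F :: ('a \<Rightarrow> real) \<Rightarrow> 'b \<Rightarrow> real)"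
    and S: "fs.subspace S" and inj: "inj_on F S" and "has_dim (F ` S) r"
  shows "has_dim S r"
proof -
  obtain C where C: "C \<subseteq> S" "finite C" "card C = r" "\<not> fs.dependent C" "F ` fs.span C = F ` S"
    using has_dim_lift_basis[OF F assms(4)] by metis
  have "fs.span C \<subseteq> S" using fs.span_minimal[OF C(1) S] .
  then have "fs.span C = S" using C(5) inj by (metis inj_on_image_eq_iff order_refl)
  then show ?thesis using C unfolding has_dim_def by blast
qed

lemma has_dim_imp_dependency:
  assumes "has_dim S r" and v: "\<And>i. v i \<in> S"
  obtains c :: "nat \<Rightarrow> real" where "\<exists>i\<le>r. c i \<noteq> 0" "(\<Sum>i\<le>r. fscale (c i) (v i)) = 0"
proof (cases "inj_on v {..r}")
  \<comment> \<open>Dependence of a set does not see repetitions, so two equal members of the family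
    need the relation \<open>v i - v j = 0\<close> separately.\<close>
  case False
  then obtain i j where ij: "i \<le> r" "j \<le> r" "i \<noteq> j" "v i = v j" by (auto simp: inj_on_def)
  let ?c = "\<lambda>k. if k = i then 1 else if k = j then -1 else (0::real)"
  have "(\<Sum>k\<le>r. fscale (?c k) (v k)) = (\<Sum>k\<in>{i,j}. fscale (?c k) (v k))"
    using ij by (intro sum.mono_neutral_right) auto
  also have "\<dots> = 0" using ij by (auto simp: fun_eq_iff)
  finally show ?thesis using ij(1) by (intro that[of ?c]) (auto intro!: exI[of _ i])
next
  case True
  obtain B where B: "finite B" "card B = r" "fs.span B = S"
    using assms(1) unfolding has_dim_def by blast
  have "fs.dependent (v ` {..r})"
    using fs.independent_span_bound[OF B(1), of "v ` {..r}"] v B card_image[OF True] by fastforce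
  then obtain u where u: "\<exists>f\<in>v ` {..r}. u f \<noteq> 0" "(\<Sum>f\<in>v ` {..r}. fscale (u f) f) = 0"
    using fs.dependent_finite[of "v ` {..r}"] by auto
  have "(\<Sum>i\<le>r. fscale (u (v i)) (v i)) = 0"
    using u(2) by (simp add: sum.reindex[OF True])
  then show ?thesis using u(1) that[of "\<lambda>i. u (v i)"] by auto
qed

section \<open>Polynomials and their dual\<close>

lemma lookup_scaleR [simp]:
  "Poly_Mapping.lookup (c *\<^sub>R p) \<alpha> = c *\<^sub>R Poly_Mapping.lookup p \<alpha>"
  unfolding scaleR_poly_mapping_def
  by (subst lookup_Abs_poly_mapping)
     (auto intro: finite_subset[OF _ finite_lookup[of p]])

lemma scaleR_poly_mapping_conv_mult:
  "c *\<^sub>R p = Poly_Mapping.single 0 (of_real c) * (p :: 'a::monoid_add \<Rightarrow>\<^sub>0 'b::real_algebra_1)"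
proof -
  have "c *\<^sub>R p = Poly_Mapping.map ((*) (of_real c)) p"
    by (rule poly_mapping_eqI) (simp add: map.rep_eq when_def scaleR_conv_of_real)
  then show ?thesis by (simp add: mult_map_scale_conv_mult)
qed

text \<open>Scaling is multiplication by a constant polynomial, so the laws reduce to those of the
  ring. The instance makes \<open>of_real\<close> available for polynomials, as \<open>ueval\<close>
  requires.\<close>

instance poly_mapping :: (comm_monoid_add, "{comm_ring_1, real_algebra_1}") real_algebra_1
proof
  fix c :: real and p q :: "'a \<Rightarrow>\<^sub>0 'b"
  show "c *\<^sub>R p * q = c *\<^sub>R (p * q)"
    by (simp add: scaleR_poly_mapping_conv_mult mult.assoc)
  show "p * c *\<^sub>R q = c *\<^sub>R (p * q)"
    by (simp add: scaleR_poly_mapping_conv_mult mult.left_commute)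
qed

text \<open>The linear extension to all polynomials of a map prescribed on monomials; both
  \<open>pair\<close> and the map \<open>\<phi>\<close> below are of this kind.\<close>

definition mext :: "(('n \<Rightarrow>\<^sub>0 nat) \<Rightarrow> 'b::real_vector) \<Rightarrow> 'n rpoly \<Rightarrow> 'b" where
  "mext \<psi> p = (\<Sum>\<alpha>\<in>Poly_Mapping.keys p. Poly_Mapping.lookup p \<alpha> *\<^sub>R \<psi> \<alpha>)"

lemma mext_superset:
  assumes "finite A" "Poly_Mapping.keys p \<subseteq> A"
  shows "mext \<psi> p = (\<Sum>\<alpha>\<in>A. Poly_Mapping.lookup p \<alpha> *\<^sub>R \<psi> \<alpha>)"
  unfolding mext_def using assms by (intro sum.mono_neutral_left) (auto simp: in_keys_iff)

lemma linear_mext: "linear (mext \<psi>)"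
proof
  fix p q :: "'a rpoly" and c :: real
  let ?A = "Poly_Mapping.keys p \<union> Poly_Mapping.keys q"
  have "finite ?A" "Poly_Mapping.keys p \<subseteq> ?A" "Poly_Mapping.keys q \<subseteq> ?A"
    "Poly_Mapping.keys (p + q) \<subseteq> ?A" by (auto dest: subsetD[OF keys_add])
  then show "mext \<psi> (p + q) = mext \<psi> p + mext \<psi> q"
    by (simp add: mext_superset[where A = ?A] lookup_add scaleR_left_distrib sum.distrib)
  have "Poly_Mapping.keys (c *\<^sub>R p) \<subseteq> Poly_Mapping.keys p" by (auto simp: in_keys_iff)
  then show "mext \<psi> (c *\<^sub>R p) = c *\<^sub>R mext \<psi> p"
    by (simp add: mext_superset[where A = "Poly_Mapping.keys p"] scaleR_sum_right)
qed

lemma mext_xmonom [simp]: "mext \<psi> (xmonom \<alpha>) = \<psi> \<alpha>"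
  by (simp add: mext_def xmonom_def)

lemma xmonom_expansion: "p = mext xmonom p"
  by (rule poly_mapping_eqI)
     (auto simp: mext_def lookup_sum xmonom_def lookup_single when_def in_keys_iff if_distrib
           sum.delta cong: if_cong)

lemma rpoly_in_span_xmonom: "p \<in> span (range xmonom)"
proof -
  have "mext xmonom p \<in> span (range xmonom)"
    unfolding mext_def by (intro span_sum span_scale span_base) auto
  then show ?thesis using xmonom_expansion[of p] by simp
qed

lemma linear_eq_xmonom:
  assumes "linear f" "linear g" "\<And>\<alpha>. f (xmonom \<alpha>) = g (xmonom \<alpha>)"
  shows "f p = g p"
  using linear_eq_on[OF assms(1,2) rpoly_in_span_xmonom] assms(3) by auto

lemma xmonom_0 [simp]: "xmonom 0 = 1"
  by (simp add: xmonom_def)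

lemma xmonom_mult: "xmonom \<alpha> * xmonom \<beta> = xmonom (\<alpha> + \<beta>)"
  by (simp add: xmonom_def mult_single)

lemma linear_mult_rpoly: "linear (\<lambda>q :: 'n rpoly. p * q)"
  by standard (simp_all add: distrib_left mult_scaleR_right)

text \<open>Induction on the total degree: a nonzero exponent vector has a positive entry, which can
  be lowered by one.\<close>

lemma exponent_induct [case_names zero add]:
  assumes "P 0" and "\<And>\<alpha> j. P \<alpha> \<Longrightarrow> P (Poly_Mapping.single j 1 + \<alpha>)"
  shows "P (\<alpha> :: 'n::finite \<Rightarrow>\<^sub>0 nat)"
proof (induction "\<Sum>j\<in>UNIV. Poly_Mapping.lookup \<alpha> j" arbitrary: \<alpha>)
  case 0
  then have "\<alpha> = 0" by (intro poly_mapping_eqI) simp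
  then show ?case using assms(1) by simp
next
  case (Suc n)
  then obtain j where j: "Poly_Mapping.lookup \<alpha> j > 0"
    by (metis (no_types, lifting) finite_class.finite_UNIV gr0I nat.distinct(1) sum_eq_0_iff)
  let ?\<beta> = "\<alpha> - Poly_Mapping.single j 1"
  have eq: "\<alpha> = Poly_Mapping.single j 1 + ?\<beta>"
    using j by (intro poly_mapping_eqI) (auto simp: lookup_add lookup_minus lookup_single when_def)
  have "(\<Sum>i\<in>UNIV. Poly_Mapping.lookup \<alpha> i) = 1 + (\<Sum>i\<in>UNIV. Poly_Mapping.lookup ?\<beta> i)"
    by (subst eq) (simp add: lookup_add sum.distrib lookup_single when_def)
  then have "n = (\<Sum>i\<in>UNIV. Poly_Mapping.lookup ?\<beta> i)" using Suc(2) by simp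
  then show ?case using Suc(1) assms(2) eq by metis
qed

text \<open>Multiplication by variables generates the monomials from \<open>1\<close>, and these
  span. Multiplicative identities can thus be checked one variable at a time.\<close>

lemma rpoly_induct [case_names one add scale var]:
  fixes p :: "'n::finite rpoly"
  assumes "P 1" and "\<And>p q. P p \<Longrightarrow> P q \<Longrightarrow> P (p + q)" and "\<And>c p. P p \<Longrightarrow> P (c *\<^sub>R p)"
    and "\<And>j p. P p \<Longrightarrow> P (xvar j * p)"
  shows "P p"
proof -
  have m: "P (xmonom \<alpha>)" for \<alpha>
    by (induction \<alpha> rule: exponent_induct)
       (use assms in \<open>auto simp: xvar_def xmonom_mult[symmetric]\<close>)
  have "subspace {p. P p}"
    unfolding subspace_def using assms(2,3) assms(3)[OF assms(1), of 0] by auto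
  then have "span (range xmonom) \<subseteq> {p. P p}" using m by (intro span_minimal) auto
  then show ?thesis using rpoly_in_span_xmonom by blast
qed

lemma mfact_neq_0 [simp]: "mfact \<alpha> \<noteq> 0"
  by (simp add: mfact_def)

lemma pair_conv_mext: "pair s = mext (\<lambda>\<alpha>. mfact \<alpha> * s \<alpha>)"
  by (simp add: fun_eq_iff pair_def mext_def mult_ac)

lemma linear_pair: "linear (pair s)"
  by (simp add: pair_conv_mext linear_mext)

lemmas pair_add = linear_add[OF linear_pair]
  and pair_diff = linear_diff[OF linear_pair]
  and pair_scale = linear_scale[OF linear_pair]
  and pair_sum = linear_sum[OF linear_pair]
  and pair_0 = linear_0[OF linear_pair]

lemma pair_xmonom: "pair s (xmonom \<alpha>) = mfact \<alpha> * s \<alpha>"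
  by (simp add: pair_conv_mext)

lemma rseries_eqI: "(\<And>q. pair s q = pair t q) \<Longrightarrow> s = t"
  by (metis ext mfact_neq_0 mult_left_cancel pair_xmonom)

lemma pair_plus: "pair (s + t) q = pair s q + pair t q"
  and pair_fscale: "pair (fscale c s) q = c * pair s q"
  by (simp_all add: pair_def sum.distrib algebra_simps sum_distrib_left)

lemma pair_star: "pair (star p s) q = pair s (p * q)"
proof (rule linear_eq_xmonom[where p = q])
  show "linear (\<lambda>q. pair s (p * q))"
    using linear_compose[OF linear_mult_rpoly linear_pair] by (simp add: o_def)
qed (simp_all add: linear_pair pair_xmonom star_def)

lemma star_add: "star (p + q) s = star p s + star q s"
  by (rule rseries_eqI) (simp add: pair_star pair_plus pair_add distrib_right)

lemma star_scale: "star (c *\<^sub>R p) s = fscale c (star p s)"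
  by (rule rseries_eqI) (simp add: pair_star pair_fscale pair_scale mult_scaleR_left)

text \<open>The factorials in \<open>pair\<close> and \<open>expser\<close> cancel, so pairing with
  \<open>expser \<xi>\<close> is evaluation at the point \<open>\<xi>\<close>. This identity is the
  key step towards its multiplicativity.\<close>

lemma pair_expser_xvar: "pair (expser \<xi>) (xvar j * p) = \<xi> j * pair (expser \<xi>) p"
proof (rule linear_eq_xmonom[where p = p])
  show "linear (\<lambda>p. pair (expser \<xi>) (xvar j * p))"
    using linear_compose[OF linear_mult_rpoly linear_pair] by (simp add: o_def)
  show "linear (\<lambda>p. \<xi> j * pair (expser \<xi>) p)"
    by standard (simp_all add: pair_add pair_scale algebra_simps)
  fix \<alpha>
  have "(\<Prod>i\<in>UNIV. \<xi> i ^ (if j = i then Suc 0 else 0)) = \<xi> j"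
    by (simp add: if_distrib prod.delta cong: if_cong)
  then show "pair (expser \<xi>) (xvar j * xmonom \<alpha>) = \<xi> j * pair (expser \<xi>) (xmonom \<alpha>)"
    by (simp add: xvar_def xmonom_mult pair_xmonom expser_def lookup_add power_add prod.distrib
        lookup_single when_def)
qed

lemma pair_expser_1 [simp]: "pair (expser \<xi>) 1 = 1"
  using pair_xmonom[of "expser \<xi>" 0] by (simp add: expser_def mfact_def)

lemma pair_expser_mult:
  "pair (expser \<xi>) (p * q) = pair (expser \<xi>) p * pair (expser \<xi>) q"
  by (induction p rule: rpoly_induct)
     (simp_all add: pair_add pair_scale pair_expser_xvar mult_scaleR_left distrib_right mult.assoc)

lemma pair_sum_left: "pair (\<Sum>i\<in>I. f i) q = (\<Sum>i\<in>I. pair (f i) q)"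
  unfolding pair_def sum_fun_apply
  by (subst sum.swap) (simp add: sum_distrib_left sum_distrib_right)

lemma pair_expser_prod: "pair (expser \<xi>) (\<Prod>i\<in>I. f i) = (\<Prod>i\<in>I. pair (expser \<xi>) (f i))"
  by (induction I rule: infinite_finite_induct) (simp_all add: pair_expser_mult)

section \<open>Flat extension\<close>

lemma subspace_prodspan: "subspace (prodspan V)"
  unfolding prodspan_def by (rule subspace_span)

lemma mult_in_prodspan: "p \<in> V \<Longrightarrow> q \<in> V \<Longrightarrow> p * q \<in> prodspan V"
  unfolding prodspan_def by (rule span_base) blast

lemma xvar_mult_in_vplus:
  assumes "subspace U" "u \<in> U"
  shows "xvar j * u \<in> vplus U"
proof -
  have "xvar j * u = 0 + (\<Sum>i\<in>UNIV. xvar i * (if i = j then u else 0))"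
    by (simp add: if_distrib sum.delta cong: if_cong)
  moreover have "0 \<in> U" "\<forall>i. (if i = j then u else 0) \<in> U"
    using assms by (auto simp: subspace_0)
  ultimately show ?thesis
    unfolding vplus_def mem_Collect_eq
    by (intro exI[of _ 0] exI[of _ "\<lambda>i. if i = j then u else 0"]) simp
qed

text \<open>The kernel of the Hankel operator \<open>p \<mapsto> star p s\<close>; it is an
  ideal.\<close>

definition annih :: "'n::finite rseries \<Rightarrow> 'n rpoly set" where
  "annih s = {p. \<forall>q. pair s (p * q) = 0}"

lemma subspace_annih: "subspace (annih s)"
  by (auto simp: subspace_def annih_def pair_0 pair_add pair_scale distrib_right
        mult_scaleR_left)

lemma annih_mult: "p \<in> annih s \<Longrightarrow> q * p \<in> annih s"
  unfolding annih_def mem_Collect_eq by (metis mult.left_commute mult.assoc)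

lemma pair_annih:
  assumes "p \<in> annih s"
  shows "pair s p = 0"
proof -
  have "pair s (p * 1) = 0" using assms unfolding annih_def by blast
  then show ?thesis by simp
qed

section \<open>Flatness: reduction of \<open>V\<close> to \<open>U\<close> modulo the kernel, and
  uniqueness\<close>

locale flat_form =
  fixes V U :: "'n::finite rpoly set" and \<sigma> :: "'n rpoly \<Rightarrow> real" and r :: nat
  assumes subspace_V: "subspace V" and conn: "connected_to_one V"
    and \<sigma>_add: "a \<in> prodspan V \<Longrightarrow> b \<in> prodspan V \<Longrightarrow> \<sigma> (a + b) = \<sigma> a + \<sigma> b"
    and \<sigma>_scale: "a \<in> prodspan V \<Longrightarrow> \<sigma> (c *\<^sub>R a) = c * \<sigma> a"
    and subspace_U: "subspace U" and U_sub_V: "U \<subseteq> V" and one_U: "1 \<in> U"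
    and U_plus: "vplus U \<subseteq> V"
    and rank_V: "rankHWW_eq \<sigma> V r" and rank_U: "rankHWW_eq \<sigma> U r"
begin

definition kerV :: "'n rpoly set" where
  "kerV = {p \<in> V. \<forall>q\<in>V. \<sigma> (p * q) = 0}"

lemma kerV_D: "k \<in> kerV \<Longrightarrow> v \<in> V \<Longrightarrow> \<sigma> (k * v) = 0"
  by (simp add: kerV_def)

lemma kerV_V: "k \<in> kerV \<Longrightarrow> k \<in> V"
  by (simp add: kerV_def)

lemma one_V: "1 \<in> V" using one_U U_sub_V by blast

lemma U_V: "u \<in> U \<Longrightarrow> u \<in> V" using U_sub_V by blast

lemma xvar_U_in_V: "u \<in> U \<Longrightarrow> xvar j * u \<in> V"
  using xvar_mult_in_vplus[OF subspace_U] U_plus by blast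

lemma \<sigma>_0: "\<sigma> 0 = 0"
  using \<sigma>_scale[OF subspace_0[OF subspace_prodspan], of 0] by simp

lemma \<sigma>_sum: "(\<And>i. i \<in> I \<Longrightarrow> f i \<in> prodspan V) \<Longrightarrow> \<sigma> (sum f I) = (\<Sum>i\<in>I. \<sigma> (f i))"
  by (induction I rule: infinite_finite_induct)
     (simp_all add: \<sigma>_0 \<sigma>_add subspace_sum[OF subspace_prodspan])

lemma \<sigma>_mult_add:
  assumes "p \<in> V" "q \<in> V" "w \<in> V"
  shows "\<sigma> ((p + q) * w) = \<sigma> (p * w) + \<sigma> (q * w)"
  using assms by (simp add: distrib_right \<sigma>_add mult_in_prodspan)

lemma \<sigma>_mult_scale:
  assumes "p \<in> V" "w \<in> V"
  shows "\<sigma> ((c *\<^sub>R p) * w) = c * \<sigma> (p * w)"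
  using assms by (simp add: mult_scaleR_left \<sigma>_scale mult_in_prodspan)

lemma \<sigma>_mult_diff:
  assumes "p \<in> V" "q \<in> V" "w \<in> V"
  shows "\<sigma> ((p - q) * w) = \<sigma> (p * w) - \<sigma> (q * w)"
  using \<sigma>_mult_add[of p "(-1) *\<^sub>R q" w] \<sigma>_mult_scale[of q w "-1"] assms
  by (simp add: subspace_neg[OF subspace_V])

lemma subspace_kerV: "subspace kerV"
  unfolding subspace_def kerV_def using subspace_V
  by (auto simp: \<sigma>_mult_add \<sigma>_scale mult_in_prodspan \<sigma>_0 subspace_add subspace_scale subspace_0)

text \<open>Restricting functionals from \<open>V\<close> to \<open>U\<close> maps the image of
  \<open>U\<close> under \<open>HWW \<sigma> V\<close> onto that under
  \<open>HWW \<sigma> U\<close>, of dimension \<open>r\<close>. Hence the image of \<open>U\<close>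
  is already the whole \<open>r\<close>-dimensional image of \<open>V\<close>, and each
  \<open>v\<close> induces the same functional as some \<open>u\<close>.\<close>

lemma U_complements_kerV:
  assumes v: "v \<in> V"
  obtains u where "u \<in> U" "v - u \<in> kerV"
proof -
  let ?F = "\<lambda>f w. if w \<in> U then f w else (0::real)"
  let ?H = "HWW \<sigma> V"
  have F: "Vector_Spaces.linear fscale fscale ?F"
    by (rule fs_linearI) (auto simp: fun_eq_iff)
  have add: "?H (p + q) = ?H p + ?H q" if "p \<in> U" "q \<in> U" for p q
    using that by (auto simp: HWW_def fun_eq_iff \<sigma>_mult_add U_V)
  have scale: "?H (c *\<^sub>R p) = fscale c (?H p)" if "p \<in> U" for p c
    using that by (auto simp: HWW_def fun_eq_iff \<sigma>_scale mult_in_prodspan U_V)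
  have "fs.subspace (?H ` U)"
  proof (rule fs.subspaceI)
    have "?H 0 = 0" by (auto simp: HWW_def fun_eq_iff \<sigma>_0)
    then show "0 \<in> ?H ` U" using subspace_0[OF subspace_U] by (metis imageI)
  next
    fix f g assume "f \<in> ?H ` U" "g \<in> ?H ` U"
    then show "f + g \<in> ?H ` U"
      using add subspace_add[OF subspace_U] by (smt (verit) image_iff)
  next
    fix c f assume "f \<in> ?H ` U"
    then show "fscale c f \<in> ?H ` U"
      using scale subspace_scale[OF subspace_U] by (smt (verit) image_iff)
  qed
  moreover have "?H ` U \<subseteq> ?H ` V" using U_sub_V by blast
  moreover have "has_dim (?H ` V) r" using rank_V by (simp add: rankHWW_eq_def)
  moreover have "?F ` ?H ` U = HWW \<sigma> U ` U"
    unfolding image_image using U_V by (intro image_cong) (auto simp: HWW_def fun_eq_iff)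
  then have "has_dim (?F ` ?H ` U) r" using rank_U by (simp add: rankHWW_eq_def)
  ultimately have "?H ` U = ?H ` V" by (rule has_dim_image_imp_eq[OF F])
  then obtain u where u: "u \<in> U" "?H v = ?H u" using v by (metis imageE imageI)
  have "\<sigma> (v * w) = \<sigma> (u * w)" if "w \<in> V" for w
    using fun_cong[OF u(2), of w] that by (simp add: HWW_def)
  then have "v - u \<in> kerV"
    using v u(1) U_V by (simp add: kerV_def subspace_diff[OF subspace_V] \<sigma>_mult_diff)
  then show ?thesis using that u(1) by blast
qed

text \<open>Testing against \<open>U\<close> is enough, because \<open>V\<close> is \<open>U\<close>
  plus the kernel and the form is symmetric.\<close>

lemma kerV_I:
  assumes v: "v \<in> V" and "\<And>u. u \<in> U \<Longrightarrow> \<sigma> (v * u) = 0"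
  shows "v \<in> kerV"
proof -
  have "\<sigma> (v * w) = 0" if "w \<in> V" for w
  proof -
    obtain u where u: "u \<in> U" "w - u \<in> kerV" using U_complements_kerV \<open>w \<in> V\<close> by blast
    have "\<sigma> (w * v) = \<sigma> ((w - u) * v) + \<sigma> (u * v)"
      using \<sigma>_mult_diff[of w u v] that u(1) v U_V by simp
    also have "\<dots> = 0" using kerV_D[OF u(2) v] assms(2)[OF u(1)] by (simp add: mult.commute)
    finally show ?thesis by (simp add: mult.commute)
  qed
  then show ?thesis using v by (simp add: kerV_def)
qed

text \<open>Since \<open>U\<close> may meet \<open>kerV\<close>, a basis of \<open>kerV\<close> is
  extended by vectors of \<open>U\<close> only; \<open>N\<close> kills the former and fixes the
  latter.\<close>

lemma flat_projection_exists:
  obtains N where "linear N" "\<And>p. N p \<in> U" "\<And>v. v \<in> V \<Longrightarrow> v - N v \<in> kerV"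
    "\<And>p. N p \<in> kerV \<Longrightarrow> N p = 0"
proof -
  obtain B1 where B1: "B1 \<subseteq> kerV" "independent B1" "kerV \<subseteq> span B1"
    using maximal_independent_subset[of kerV] by metis
  have spB1: "span B1 = kerV"
    using span_minimal[OF B1(1) subspace_kerV] B1(3) by blast
  have "B1 \<subseteq> B1 \<union> U" by blast
  then obtain B where B: "B1 \<subseteq> B" "B \<subseteq> B1 \<union> U" "independent B" "B1 \<union> U \<subseteq> span B"
    using maximal_independent_subset_extend[OF _ B1(2)] by metis
  let ?f = "\<lambda>x. if x \<in> B1 then 0 else x"
  \<comment> \<open>Prescribing the range places \<open>N p\<close> in \<open>U\<close> and makes
    \<open>N\<close> idempotent on all polynomials, also outside \<open>V\<close>.\<close>
  obtain N where N: "linear N" "\<forall>x\<in>B. N x = ?f x" "range N = span (?f ` B)"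
    using linear_independent_extend_subspace[OF B(3), of ?f] by blast
  have ran: "N p \<in> span (?f ` B)" for p using N(3) by blast
  have "?f ` B \<subseteq> U" using B(2) subspace_0[OF subspace_U] by auto
  then have NU: "N p \<in> U" for p
    using ran span_minimal[OF _ subspace_U, of "?f ` B"] by blast
  have N_fix: "N q = q" if "q \<in> span (?f ` B)" for q
  proof -
    have "N x = id x" if "x \<in> ?f ` B" for x using that N(2) linear_0[OF N(1)] by auto
    then show ?thesis using linear_eq_on[OF N(1) linear_id that] by simp
  qed
  have ker0: "N q = 0" if "q \<in> kerV" for q
  proof -
    have "N x = 0" if "x \<in> B1" for x using that N(2) B(1) by auto
    then show ?thesis using linear_eq_on[OF N(1) linear_zero, of q B1] that spB1 by simp
  qed
  have V_sub: "V \<subseteq> span B"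
  proof
    fix v assume "v \<in> V"
    then obtain u where u: "u \<in> U" "v - u \<in> kerV" using U_complements_kerV by blast
    have "v - u \<in> span B" using u(2) spB1 span_mono[OF B(1)] by blast
    moreover have "u \<in> span B" using u(1) B(4) by blast
    ultimately have "(v - u) + u \<in> span B" by (rule span_add)
    then show "v \<in> span B" by simp
  qed
  have "v - N v \<in> kerV" if "v \<in> V" for v
  proof -
    have "v \<in> span B" using that V_sub by blast
    then show ?thesis
    proof (induction rule: span_induct)
      case base
      have "linear (\<lambda>v. v - N v)" using N(1) linear_id
        by (intro linear_compose_sub) (simp_all add: id_def)
      then show ?case using subspace_kerV 
        by (rule linear_subspace_linear_preimage)
    next
      case (step x)
      then show ?case using N(2) B1(1) subspace_0[OF subspace_kerV] by auto
    qed
  qed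
  moreover have "N p = 0" if "N p \<in> kerV" for p
    using N_fix[OF ran] ker0[OF that] by simp
  ultimately show ?thesis using that N(1) NU by blast
qed

text \<open>Modulo an ideal containing \<open>kerV\<close>, multiplying an element of \<open>U\<close> by a variable gives an
  element of \<open>V\<close>, which can again be replaced by an element of \<open>U\<close>.\<close>

lemma U_complements_ideal:
  assumes A: "subspace A" "kerV \<subseteq> A" "\<And>p q. p \<in> A \<Longrightarrow> q * p \<in> A"
  shows "\<exists>u\<in>U. p - u \<in> A"
proof (induction p rule: rpoly_induct)
  case one
  then show ?case using one_U subspace_0[OF A(1)] by force
next
  case (add p q)
  then obtain u w where "u \<in> U" "p - u \<in> A" "w \<in> U" "q - w \<in> A" by blast
  then have "u + w \<in> U" "(p + q) - (u + w) \<in> A"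
    using subspace_add[OF subspace_U] subspace_add[OF A(1), of "p - u" "q - w"]
    by (auto simp: algebra_simps)
  then show ?case by blast
next
  case (scale c p)
  then obtain u where "u \<in> U" "p - u \<in> A" by blast
  then have "c *\<^sub>R u \<in> U" "c *\<^sub>R p - c *\<^sub>R u \<in> A"
    using subspace_scale[OF subspace_U] subspace_scale[OF A(1), of "p - u" c]
    by (auto simp: algebra_simps)
  then show ?case by blast
next
  case (var j p)
  then obtain u where u: "u \<in> U" "p - u \<in> A" by blast
  obtain w where w: "w \<in> U" "xvar j * u - w \<in> kerV"
    using U_complements_kerV[OF xvar_U_in_V[OF u(1)]] by blast
  have "xvar j * (p - u) + (xvar j * u - w) \<in> A"
    using A(2,3) u(2) w(2) by (intro subspace_add[OF A(1)]) auto
  then show ?case using w(1) by (auto simp: algebra_simps)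
qed

definition extends :: "'n rseries \<Rightarrow> bool" where
  "extends s \<longleftrightarrow> (\<forall>q\<in>prodspan V. pair s q = \<sigma> q)"

lemma extends_mult: "extends s \<Longrightarrow> p \<in> V \<Longrightarrow> q \<in> V \<Longrightarrow> pair s (p * q) = \<sigma> (p * q)"
  by (simp add: extends_def mult_in_prodspan)

text \<open>Flatness again, now for the Hankel operator of \<open>s\<close>: every
  \<open>star q s\<close> equals \<open>star u s\<close> with \<open>u\<close> in \<open>U\<close>,
  and \<open>u * k\<close> is a product of elements of \<open>V\<close>, where \<open>s\<close>
  agrees with \<open>\<sigma>\<close>.\<close>

lemma kerV_sub_annih:
  assumes s: "extends s" "rankH_eq s r"
  shows "kerV \<subseteq> annih s"
proof
  fix k assume k: "k \<in> kerV"
  let ?S = "(\<lambda>p. star p s) ` U" and ?T = "range (\<lambda>p. star p s)"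
  let ?F = "\<lambda>f w. if w \<in> U then pair f w else 0"
  have F: "Vector_Spaces.linear fscale fscale ?F"
    by (rule fs_linearI) (auto simp: fun_eq_iff pair_plus pair_fscale)
  have "fs.subspace ?S"
  proof (rule fs.subspaceI)
    have "star 0 s = 0" using star_scale[of 0 0 s] by simp
    then show "0 \<in> ?S" using subspace_0[OF subspace_U] by (metis imageI)
  qed (auto simp: star_add[symmetric] star_scale[symmetric] subspace_add[OF subspace_U]
      subspace_scale[OF subspace_U])
  moreover have "?S \<subseteq> ?T" by blast
  moreover have "has_dim ?T r" using s(2) by (simp add: rankH_eq_def)
  moreover have "?F ` ?S = HWW \<sigma> U ` U"
    unfolding image_image using U_V s(1)
    by (intro image_cong) (auto simp: HWW_def fun_eq_iff pair_star extends_mult)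
  then have "has_dim (?F ` ?S) r" using rank_U by (simp add: rankHWW_eq_def)
  ultimately have ST: "?S = ?T" by (rule has_dim_image_imp_eq[OF F])
  have "pair s (k * q) = 0" for q
  proof -
    obtain u where u: "u \<in> U" "star q s = star u s" using ST by (metis imageE rangeI)
    have "pair s (q * k) = pair s (u * k)" using u(2) by (metis pair_star)
    also have "\<dots> = \<sigma> (u * k)" using extends_mult[OF s(1)] u(1) U_V kerV_V[OF k] by blast
    also have "\<dots> = 0" using kerV_D[OF k U_V[OF u(1)]] by (simp add: mult.commute)
    finally show ?thesis by (simp add: mult.commute)
  qed
  then show "k \<in> annih s" by (simp add: annih_def)
qed

lemma flat_extension_unique:
  assumes "extends s" "rankH_eq s r" "extends t" "rankH_eq t r"
  shows "s = t"
proof (rule rseries_eqI)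
  fix p
  \<comment> \<open>Working modulo the intersection of the two ideals gives one \<open>u\<close>
    that serves both series.\<close>
  have "\<exists>u\<in>U. p - u \<in> annih s \<inter> annih t"
    using kerV_sub_annih assms annih_mult
    by (intro U_complements_ideal) (auto simp: subspace_inter subspace_annih)
  then obtain u where u: "u \<in> U" "p - u \<in> annih s" "p - u \<in> annih t" by blast
  have "pair s p = pair s u" "pair t p = pair t u"
    using pair_annih[OF u(2)] pair_annih[OF u(3)] by (simp_all add: pair_diff)
  moreover have "pair s u = \<sigma> u" "pair t u = \<sigma> u"
    using extends_mult[of _ u 1] assms u(1) U_V one_V by simp_all
  ultimately show "pair s p = pair t p" by simp
qed

end

section \<open>Construction of the extension from commuting multiplication operators\<close>

locale flat_projection = flat_form +
  fixes N :: "'a rpoly \<Rightarrow> 'a rpoly"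
  assumes linear_N: "linear N" and N_U: "N p \<in> U"
    and N_kerV: "v \<in> V \<Longrightarrow> v - N v \<in> kerV" and N_eq_0: "N p \<in> kerV \<Longrightarrow> N p = 0"
begin

lemma N_V: "N p \<in> V" using N_U U_V by blast

lemma \<sigma>_N: "v \<in> V \<Longrightarrow> w \<in> V \<Longrightarrow> \<sigma> (N v * w) = \<sigma> (v * w)"
  using \<sigma>_mult_diff[of v "N v" w] kerV_D[OF N_kerV, of v w] N_V by simp

text \<open>The range of \<open>N\<close> meets \<open>kerV\<close> only in \<open>0\<close>, so
  values of \<open>N\<close> on \<open>V\<close> are determined by pairings with
  \<open>U\<close>.\<close>

lemma N_cong:
  assumes "v \<in> V" "w \<in> V" "\<And>u. u \<in> U \<Longrightarrow> \<sigma> (v * u) = \<sigma> (w * u)"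
  shows "N v = N w"
proof -
  have "\<sigma> (N (v - w) * u) = 0" if "u \<in> U" for u
    using assms that U_V by (simp add: \<sigma>_N \<sigma>_mult_diff subspace_diff[OF subspace_V])
  then have "N (v - w) = 0" by (intro N_eq_0 kerV_I N_V)
  then show ?thesis by (simp add: linear_diff[OF linear_N])
qed

lemma N_N: "N (N p) = N p"
proof -
  have "N (p - N p) \<in> kerV"
    using N_kerV[OF N_V, of p] by (simp add: linear_diff[OF linear_N])
  then show ?thesis using N_eq_0[of "p - N p"] by (simp add: linear_diff[OF linear_N])
qed

text \<open>Multiplication by \<open>xvar j\<close> in the quotient by the kernel. The inner
  \<open>N\<close> first moves \<open>p\<close> into \<open>U\<close>, so that the product lies in
  \<open>V\<close> for every polynomial \<open>p\<close>.\<close>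

definition T :: "'a \<Rightarrow> 'a rpoly \<Rightarrow> 'a rpoly" where
  "T j p = N (xvar j * N p)"

lemma linear_T: "linear (T j)"
  unfolding T_def
  using linear_compose[OF linear_compose[OF linear_N linear_mult_rpoly] linear_N]
  by (simp add: o_def)

lemma T_commute: "T i (T j p) = T j (T i p)"
  unfolding T_def N_N
proof (rule N_cong)
  fix u assume u: "u \<in> U"
  have eq: "\<sigma> (xvar i * N (xvar j * N p) * u) = \<sigma> (xvar i * xvar j * N p * u)" for i j
    using \<sigma>_N[OF xvar_U_in_V xvar_U_in_V, OF N_U u] by (simp add: mult_ac)
  show "\<sigma> (xvar i * N (xvar j * N p) * u) = \<sigma> (xvar j * N (xvar i * N p) * u)"
    unfolding eq by (simp add: mult_ac)
qed (simp_all add: xvar_U_in_V N_U)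

lemma comp_fun_commute_T: "comp_fun_commute (\<lambda>j. T j ^^ e j)"
proof -
  interpret comp_fun_commute T by standard (simp add: fun_eq_iff T_commute)
  show ?thesis by (rule comp_fun_commute_funpow)
qed

text \<open>The monomial of exponent \<open>\<alpha>\<close> in the operators \<open>T j\<close>,
  applied to \<open>N 1\<close>. The fold is independent of the order of the variables because these
  operators commute.\<close>

definition \<psi> :: "('a \<Rightarrow>\<^sub>0 nat) \<Rightarrow> 'a rpoly" where
  "\<psi> \<alpha> = Finite_Set.fold (\<lambda>j. T j ^^ Poly_Mapping.lookup \<alpha> j) (N 1) UNIV"

lemma \<psi>_0: "\<psi> 0 = N 1"
proof -
  have "Finite_Set.fold (\<lambda>j. id) (N 1) J = N 1" if "finite J" for J :: "'a set"
  proof -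
    interpret comp_fun_commute "\<lambda>j::'a. id :: 'a rpoly \<Rightarrow> _" by standard simp
    show ?thesis using that by induction (simp, metis fold_insert id_apply)
  qed
  then show ?thesis by (simp add: \<psi>_def)
qed

lemma \<psi>_add: "\<psi> (Poly_Mapping.single j 1 + \<alpha>) = T j (\<psi> \<alpha>)"
proof -
  let ?f = "\<lambda>\<alpha> j. T j ^^ Poly_Mapping.lookup \<alpha> j"
  let ?\<beta> = "Poly_Mapping.single j 1 + \<alpha>"
  \<comment> \<open>The power of \<open>T j\<close> is split off, leaving a fold over the other
    variables that is unaffected by raising the exponent of \<open>j\<close>.\<close>
  have rec: "\<psi> \<alpha> = ?f \<alpha> j (Finite_Set.fold (?f \<alpha>) (N 1) (UNIV - {j}))" for \<alpha>
  proof -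
    interpret comp_fun_commute "?f \<alpha>" by (rule comp_fun_commute_T)
    show ?thesis unfolding \<psi>_def by (rule fold_rec) auto
  qed
  have "Finite_Set.fold (?f ?\<beta>) (N 1) (UNIV - {j}) = Finite_Set.fold (?f \<alpha>) (N 1) (UNIV - {j})"
  proof (rule Finite_Set.fold_cong[where S = UNIV])
    fix i assume "i \<in> UNIV - {j}"
    then show "?f ?\<beta> i = ?f \<alpha> i" by (simp add: lookup_add lookup_single)
  qed (use comp_fun_commute_T in \<open>simp_all add: comp_fun_commute_def'\<close>)
  then show ?thesis using rec[of ?\<beta>] rec[of \<alpha>] by (simp add: lookup_add)
qed

definition \<phi> :: "'a rpoly \<Rightarrow> 'a rpoly" where
  "\<phi> = mext \<psi>"

lemma linear_\<phi>: "linear \<phi>"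
  unfolding \<phi>_def by (rule linear_mext)

lemma \<phi>_1: "\<phi> 1 = N 1"
  using mext_xmonom[of \<psi> 0] by (simp add: \<phi>_def \<psi>_0)

lemma \<phi>_xvar_T: "\<phi> (xvar j * p) = T j (\<phi> p)"
proof (rule linear_eq_xmonom[where p = p])
  show "linear (\<lambda>p. \<phi> (xvar j * p))" "linear (\<lambda>p. T j (\<phi> p))"
    using linear_compose[OF linear_mult_rpoly linear_\<phi>] linear_compose[OF linear_\<phi> linear_T]
    by (simp_all add: o_def)
qed (simp add: \<phi>_def xvar_def xmonom_mult \<psi>_add del: One_nat_def)

lemma N_\<phi>: "N (\<phi> p) = \<phi> p"
  by (induction p rule: rpoly_induct)
     (simp_all add: \<phi>_1 N_N \<phi>_xvar_T T_def linear_add[OF linear_N] linear_add[OF linear_\<phi>]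
        linear_scale[OF linear_N] linear_scale[OF linear_\<phi>])

lemma \<phi>_xvar: "\<phi> (xvar j * p) = N (xvar j * \<phi> p)"
  by (simp add: \<phi>_xvar_T T_def N_\<phi>)

lemma \<phi>_U: "\<phi> p \<in> U"
  using N_U[of "\<phi> p"] by (simp add: N_\<phi>)

lemma \<phi>_V: "\<phi> p \<in> V"
  using \<phi>_U U_V by blast

text \<open>Along the chain from \<open>1\<close> to \<open>V\<close> the products \<open>xvar j * w j\<close> need not lie in \<open>V\<close>
  individually, only their sum does; hence both sides are compared after pairing with \<open>U\<close>.\<close>

lemma \<phi>_eq_N:
  assumes "v \<in> V"
  shows "\<phi> v = N v"
proof -
  obtain s Vs where Vs: "Vs 0 = span {1}" "Vs s = V"
      "\<And>l. l < s \<Longrightarrow> Vs l \<subseteq> Vs (Suc l)" "\<And>l. l < s \<Longrightarrow> Vs (Suc l) \<subseteq> vplus (Vs l)"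
    using conn unfolding connected_to_one_def by auto
  have sub: "Vs l \<subseteq> V" if "l \<le> s" for l
    using that by (induction rule: inc_induct) (use Vs in auto)
  have "\<forall>v\<in>Vs l. \<phi> v = N v" if "l \<le> s" for l
    using that
  proof (induction l)
    case 0
    then show ?case
      by (auto simp: Vs(1) span_singleton \<phi>_1 linear_scale[OF linear_N] linear_scale[OF linear_\<phi>])
  next
    case (Suc l)
    show ?case
    proof
      fix v assume v: "v \<in> Vs (Suc l)"
      then obtain v0 w where w: "v = v0 + (\<Sum>j\<in>UNIV. xvar j * w j)" "v0 \<in> Vs l" "\<And>j. w j \<in> Vs l"
        using Vs(4)[of l] Suc(2) unfolding vplus_def by auto
      have in_V: "v \<in> V" "v0 \<in> V" "w j \<in> V" for j
        using sub[of l] sub[of "Suc l"] Suc(2) v w by auto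
      have IH: "\<phi> v0 = N v0" "\<phi> (w j) = N (w j)" for j using Suc w by auto
      let ?v = "v0 + (\<Sum>j\<in>UNIV. xvar j * N (w j))"
      have "\<phi> v = N ?v"
        by (simp add: w(1) linear_add[OF linear_\<phi>] linear_sum[OF linear_\<phi>] linear_add[OF linear_N]
            linear_sum[OF linear_N] \<phi>_xvar IH)
      also have "\<dots> = N v"
      proof (rule N_cong)
        show "?v \<in> V" using in_V N_U
          by (intro subspace_add subspace_sum subspace_V xvar_U_in_V) auto
        fix u assume u: "u \<in> U"
        have expand: "\<sigma> ((v0 + (\<Sum>j\<in>UNIV. xvar j * f j)) * u)
            = \<sigma> (v0 * u) + (\<Sum>j\<in>UNIV. \<sigma> (f j * (xvar j * u)))" if f: "\<And>j. f j \<in> V" for f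
        proof -
          have "(v0 + (\<Sum>j\<in>UNIV. xvar j * f j)) * u = v0 * u + (\<Sum>j\<in>UNIV. f j * (xvar j * u))"
            by (simp add: distrib_right sum_distrib_right mult.assoc mult.left_commute)
          moreover have "f j * (xvar j * u) \<in> prodspan V" for j
            using f xvar_U_in_V[OF u] by (rule mult_in_prodspan)
          moreover have "v0 * u \<in> prodspan V" using in_V(2) U_V[OF u] by (rule mult_in_prodspan)
          ultimately show ?thesis
            by (simp add: \<sigma>_add \<sigma>_sum subspace_sum[OF subspace_prodspan])
        qed
        show "\<sigma> (?v * u) = \<sigma> (v * u)"
          unfolding w(1) by (simp add: expand N_V in_V \<sigma>_N xvar_U_in_V u)
      qed (fact in_V(1))
      finally show "\<phi> v = N v" .
    qed
  qed
  then show ?thesis using Vs(2) assms by blast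
qed

text \<open>With \<open>q\<close> arbitrary, a variable split off from \<open>p\<close> moves over
  to \<open>q\<close> in the induction hypothesis; \<open>\<sigma>_N\<close>, used twice, moves it
  back.\<close>

lemma \<sigma>_\<phi>_mult: "\<sigma> (\<phi> (p * q)) = \<sigma> (\<phi> p * \<phi> q)"
proof (induction p arbitrary: q rule: rpoly_induct)
  case one
  then show ?case using \<sigma>_N[OF one_V \<phi>_V, of q] by (simp add: \<phi>_1)
next
  case (add p p')
  have "\<sigma> (\<phi> a) = \<sigma> (\<phi> a * 1)" for a by simp
  then show ?case
    by (metis (no_types, lifting) add \<sigma>_mult_add \<phi>_V distrib_right linear_\<phi> linear_add one_V)
next
  case (scale c p)
  have "\<sigma> (\<phi> a) = \<sigma> (\<phi> a * 1)" for a by simp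
  then show ?case
    by (metis (no_types, lifting) scale \<sigma>_mult_scale \<phi>_V mult_scaleR_left linear_\<phi>
        linear_scale one_V)
next
  case (var j p)
  have "\<sigma> (\<phi> (xvar j * p * q)) = \<sigma> (\<phi> p * \<phi> (xvar j * q))"
    using var[of "xvar j * q"] by (simp add: mult_ac)
  also have "\<dots> = \<sigma> (xvar j * \<phi> q * \<phi> p)"
    unfolding \<phi>_xvar using \<sigma>_N[OF xvar_U_in_V[OF \<phi>_U] \<phi>_V, of j q p] by (simp add: mult_ac)
  also have "\<dots> = \<sigma> (\<phi> (xvar j * p) * \<phi> q)"
    unfolding \<phi>_xvar using \<sigma>_N[OF xvar_U_in_V[OF \<phi>_U] \<phi>_V, of j p q] by (simp add: mult_ac)
  finally show ?case .
qed

definition ext :: "'a rseries" where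
  "ext \<alpha> = \<sigma> (\<phi> (xmonom \<alpha>)) / mfact \<alpha>"

lemma pair_ext: "pair ext p = \<sigma> (\<phi> p)"
proof (rule linear_eq_xmonom[where p = p])
  show "linear (\<lambda>p. \<sigma> (\<phi> p))"
  proof
    fix p q :: "'a rpoly" and c :: real
    show "\<sigma> (\<phi> (p + q)) = \<sigma> (\<phi> p) + \<sigma> (\<phi> q)"
      using \<sigma>_mult_add[OF \<phi>_V \<phi>_V one_V] by (simp add: linear_add[OF linear_\<phi>])
    show "\<sigma> (\<phi> (c *\<^sub>R p)) = c *\<^sub>R \<sigma> (\<phi> p)"
      using \<sigma>_mult_scale[OF \<phi>_V one_V] by (simp add: linear_scale[OF linear_\<phi>])
  qed
qed (simp_all add: linear_pair pair_xmonom ext_def)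

lemma pair_ext_mult_V:
  assumes "w \<in> V"
  shows "pair ext (p * w) = \<sigma> (\<phi> p * w)"
  using \<sigma>_N[OF assms \<phi>_V, of p] by (simp add: pair_ext \<sigma>_\<phi>_mult \<phi>_eq_N[OF assms] mult.commute)

lemma extends_ext: "extends ext"
  unfolding extends_def
proof
  fix q assume "q \<in> prodspan V"
  then have "q \<in> span {p * q |p q. p \<in> V \<and> q \<in> V}" by (simp add: prodspan_def)
  \<comment> \<open>Membership is carried along because \<open>\<sigma>\<close> is known to be
    linear only on \<open>prodspan V\<close>.\<close>
  then have "q \<in> prodspan V \<and> pair ext q = \<sigma> q"
  proof (induction rule: span_induct_alt)
    case base
    then show ?case by (simp add: pair_0 \<sigma>_0 subspace_0[OF subspace_prodspan])
  next
    case (step c x y)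
    then obtain p q where x: "x = p * q" "p \<in> V" "q \<in> V" by blast
    have "pair ext x = \<sigma> x"
      using pair_ext_mult_V[OF x(3), of p] \<sigma>_N[OF x(2,3)] x by (simp add: \<phi>_eq_N)
    moreover have xp: "x \<in> prodspan V" using mult_in_prodspan x by blast
    ultimately show ?case using step(2)
      by (simp add: pair_add pair_scale \<sigma>_add \<sigma>_scale subspace_add[OF subspace_prodspan]
          subspace_scale[OF subspace_prodspan])
  qed
  then show "pair ext q = \<sigma> q" by blast
qed

text \<open>Restricting pairings to \<open>V\<close> turns \<open>star p ext\<close> into the
  functional of \<open>\<phi> p\<close>. This loses nothing, since products with arbitrary
  polynomials reduce to products with values of \<open>\<phi>\<close>, and it reaches the functional
  of every \<open>v\<close> in \<open>V\<close>, as \<open>\<phi> v = N v\<close>.\<close>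

lemma rankH_ext: "rankH_eq ext r"
  unfolding rankH_eq_def
proof (rule has_dim_inj_image)
  let ?S = "range (\<lambda>p. star p ext)"
  let ?F = "\<lambda>f w. if w \<in> V then pair f w else 0"
  show F: "Vector_Spaces.linear fscale fscale ?F"
    by (rule fs_linearI) (auto simp: fun_eq_iff pair_plus pair_fscale)
  show "fs.subspace ?S"
  proof (rule fs.subspaceI)
    have "star 0 ext = 0" using star_scale[of 0 0 ext] by simp
    then show "0 \<in> ?S" by (metis rangeI)
  qed (auto simp: star_add[symmetric] star_scale[symmetric])
  have F_star: "?F (star p ext) = HWW \<sigma> V (\<phi> p)" for p
    by (simp add: fun_eq_iff HWW_def pair_star pair_ext_mult_V)
  show "inj_on ?F ?S"
  proof (rule inj_onI, clarify)
    fix p q assume "?F (star p ext) = ?F (star q ext)"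
    then have "HWW \<sigma> V (\<phi> p) = HWW \<sigma> V (\<phi> q)" by (simp only: F_star)
    then have "\<sigma> (\<phi> p * w) = \<sigma> (\<phi> q * w)" if "w \<in> V" for w
      using that by (metis HWW_def)
    then have "pair ext (p * a) = pair ext (q * a)" for a
      by (simp add: pair_ext \<sigma>_\<phi>_mult \<phi>_V)
    then show "star p ext = star q ext" by (intro rseries_eqI) (simp add: pair_star)
  qed
  have "HWW \<sigma> V v \<in> ?F ` ?S" if "v \<in> V" for v
  proof -
    have "HWW \<sigma> V v = HWW \<sigma> V (\<phi> v)" using that by (auto simp: HWW_def fun_eq_iff \<phi>_eq_N \<sigma>_N)
    then have "HWW \<sigma> V v = ?F (star v ext)" by (simp only: F_star)
    then show ?thesis by blast
  qed
  moreover have "?F (star p ext) \<in> HWW \<sigma> V ` V" for p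
    unfolding F_star using \<phi>_V by blast
  ultimately have "?F ` ?S = HWW \<sigma> V ` V" by blast
  then show "has_dim (?F ` ?S) r" using rank_V by (simp add: rankHWW_eq_def)
qed

end

lemma (in flat_form) flat_extension_exists: "\<exists>s. extends s \<and> rankH_eq s r"
proof -
  obtain N where "linear N" "\<And>p. N p \<in> U" "\<And>v. v \<in> V \<Longrightarrow> v - N v \<in> kerV"
    "\<And>p. N p \<in> kerV \<Longrightarrow> N p = 0"
    using flat_projection_exists by blast
  then interpret flat_projection V U \<sigma> r N
    by (intro flat_projection.intro flat_projection_axioms.intro flat_form_axioms)
  show ?thesis using extends_ext rankH_ext by blast
qed

section \<open>Univariate real polynomials\<close>

text \<open>Evaluation in an arbitrary commutative real algebra: it is used both at complex roots
  and at multivariate polynomials.\<close>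

definition ueval :: "real poly \<Rightarrow> 'a \<Rightarrow> 'a::{comm_ring_1, real_algebra_1}" where
  "ueval f x = poly (map_poly of_real f) x"

lemma ueval_0 [simp]: "ueval 0 x = 0"
  by (simp add: ueval_def)

lemma ueval_pCons [simp]: "ueval (pCons a f) x = of_real a + x * ueval f x"
  by (simp add: ueval_def map_poly_pCons)

lemma ueval_1 [simp]: "ueval 1 x = 1"
  by (simp add: one_pCons)

lemma ueval_add: "ueval (f + g) x = ueval f x + ueval g x"
  by (induction f g rule: poly_induct2) (simp_all add: algebra_simps)

lemma ueval_smult: "ueval (smult c f) x = of_real c * ueval f x"
  by (induction f) (simp_all add: algebra_simps)

lemma ueval_mult: "ueval (f * g) x = ueval f x * ueval g x"
  by (induction f) (simp_all add: ueval_add ueval_smult algebra_simps)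

lemma ueval_sum: "ueval (\<Sum>i\<in>I. f i) x = (\<Sum>i\<in>I. ueval (f i) x)"
  by (induction I rule: infinite_finite_induct) (simp_all add: ueval_add)

lemma ueval_prod: "ueval (\<Prod>i\<in>I. f i) x = (\<Prod>i\<in>I. ueval (f i) x)"
  by (induction I rule: infinite_finite_induct) (simp_all add: ueval_mult)

lemma ueval_monom: "ueval (monom c i) x = of_real c * x ^ i"
  by (induction i) (simp_all add: monom_0 monom_Suc mult_ac)

lemma pair_expser_ueval: "pair (expser \<xi>) (ueval f (xvar j)) = poly f (\<xi> j)"
proof (induction f)
  case (pCons a f)
  have "pair (expser \<xi>) (of_real a) = a"
    using pair_scale[of "expser \<xi>" a 1] by (simp add: of_real_def)
  then show ?case using pCons by (simp add: pair_add pair_expser_xvar)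
qed (simp add: pair_0)

text \<open>Take a complex root. A real one gives a linear factor; a nonreal one gives the real
  quadratic with that root and its conjugate.\<close>

lemma real_poly_factor_cases:
  fixes f :: "real poly"
  assumes "degree f > 0"
  obtains (linear) a g where "f = [:-a, 1:] * g"
    | (quadratic) a b g where "b \<noteq> 0" "f = ([:-a, 1:]^2 + [:b^2:]) * g"
proof -
  have "\<not> constant (poly (map_poly complex_of_real f))"
    using assms by (simp add: constant_degree degree_map_poly)
  then obtain z :: complex where z: "ueval f z = 0"
    unfolding ueval_def using fundamental_theorem_of_algebra by blast
  define a b where "a = Re z" and "b = Im z"
  have z_eq: "z = Complex a b" by (simp add: a_def b_def)
  show ?thesis
  proof (cases "b = 0")
    case True
    have "ueval f (of_real a) = (of_real (poly f a) :: complex)"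
      by (induction f) simp_all
    moreover have "z = of_real a" by (simp add: z_eq True complex_of_real_def)
    ultimately have "poly f a = 0" using z by simp
    then have "[:-a, 1:] dvd f" by (simp add: poly_eq_0_iff_dvd)
    then show ?thesis using linear by (auto simp: dvd_def)
  next
    case False
    define q where "q = [:-a, 1:]^2 + [:b^2:]"
    have q_eq: "q = [:a^2 + b^2, -2 * a, 1:]" by (simp add: q_def power2_eq_square)
    define c d where "c = coeff (f mod q) 0" and "d = coeff (f mod q) 1"
    have "degree (f mod q) < 2"
      using degree_mod_less[of q f] by (auto simp: q_eq)
    then have "f mod q = [:c, d:]"
      by (intro poly_eqI) (auto simp: c_def d_def coeff_pCons coeff_eq_0 split: nat.split)
    then have f_eq: "f = q * (f div q) + [:c, d:]" by (metis mult_div_mod_eq)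
    have "ueval q z = 0"
      by (simp add: q_eq z_eq complex_eq_iff power2_eq_square algebra_simps)
    then have "ueval [:c, d:] z = 0"
      using z by (subst (asm) f_eq) (simp add: ueval_add ueval_mult)
    \<comment> \<open>The remainder has real coefficients and degree at most one, so a root with
      \<open>b \<noteq> 0\<close> forces it to vanish.\<close>
    then have "d = 0 \<and> c = 0" using False by (auto simp: z_eq complex_eq_iff)
    then have "f = q * (f div q)" using f_eq by simp
    then show ?thesis using quadratic[OF False] q_def by blast
  qed
qed

definition lagrange :: "real set \<Rightarrow> real \<Rightarrow> real poly" where
  "lagrange A a = (\<Prod>b\<in>A - {a}. smult (1 / (a - b)) [:-b, 1:])"

lemma poly_lagrange:
  assumes "finite A" "c \<in> A"
  shows "poly (lagrange A a) c = (if c = a then 1 else 0)"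
proof (cases "c = a")
  case True
  have "poly (smult (1 / (a - b)) [:-b, 1:]) a = 1" if "b \<in> A - {a}" for b
    using that by (simp add: divide_simps)
  then show ?thesis using True by (simp add: lagrange_def poly_prod del: poly_smult poly_pCons)
next
  case False
  then have "\<exists>b\<in>A - {a}. poly (smult (1 / (a - b)) [:-b, 1:]) c = 0"
    using assms by (intro bexI[of _ c]) auto
  then show ?thesis using False assms(1) by (simp add: lagrange_def poly_prod prod_zero)
qed

lemma degree_lagrange:
  assumes "finite A" "a \<in> A"
  shows "degree (lagrange A a) < card A"
proof -
  have "degree (lagrange A a) \<le> (\<Sum>b\<in>A - {a}. degree (smult (1 / (a - b)) [:-b, 1:]))"
    unfolding lagrange_def using assms(1) by (intro degree_prod_sum_le[unfolded o_def]) auto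
  also have "\<dots> \<le> (\<Sum>b\<in>A - {a}. 1)"
    by (intro sum_mono) (auto intro: order_trans[OF degree_smult_le])
  also have "\<dots> < card A"
    using card_Diff1_less[OF assms] by simp
  finally show ?thesis .
qed

lemma sum_lagrange:
  assumes "finite A" "A \<noteq> {}"
  shows "(\<Sum>a\<in>A. lagrange A a) = 1"
proof (rule poly_eqI_degree[where A = A])
  show "poly (\<Sum>a\<in>A. lagrange A a) c = poly 1 c" if "c \<in> A" for c
    using that assms(1) by (simp add: poly_sum poly_lagrange sum.delta)
  have "degree (\<Sum>a\<in>A. lagrange A a) \<le> card A - 1"
    using assms(1) degree_lagrange[OF assms(1)] by (intro degree_sum_le) fastforce+
  then show "degree (\<Sum>a\<in>A. lagrange A a) < card A" and "degree (1 :: real poly) < card A"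
    using card_gt_0_iff[of A] assms by auto
qed

text \<open>The linear factor is exactly the one missing from the Lagrange product. This makes
  Lagrange polynomials eigenvectors modulo the full product.\<close>

lemma linear_factor_mult_lagrange:
  assumes "finite A" "a \<in> A"
  shows "[:-a, 1:] * lagrange A a = smult (\<Prod>b\<in>A - {a}. 1 / (a - b)) (\<Prod>b\<in>A. [:-b, 1:])"
  unfolding lagrange_def prod_smult prod.remove[OF assms] by (simp only: mult_smult_right)

section \<open>Positive forms of finite rank\<close>

locale psd_finite_rank =
  fixes s :: "'n::finite rseries" and r :: nat
  assumes rank: "rankH_eq s r" and psd: "pair s (p * p) \<ge> 0"
begin

lemmas annih_add = subspace_add[OF subspace_annih]
  and annih_scale = subspace_scale[OF subspace_annih]

text \<open>As in the Cauchy-Schwarz inequality, an isotropic vector of a positive semidefinite form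
  lies in its kernel.\<close>

lemma square_annih:
  assumes "pair s (p * p) = 0"
  shows "p \<in> annih s"
proof (rule ccontr)
  assume "p \<notin> annih s"
  then obtain q where q: "pair s (p * q) \<noteq> 0" by (auto simp: annih_def)
  \<comment> \<open>As \<open>p\<close> is isotropic, the form at \<open>t *\<^sub>R p + q\<close>
    is affine in \<open>t\<close>; this \<open>t\<close> gives it the value -1.\<close>
  define t where "t = - (pair s (q * q) + 1) / (2 * pair s (p * q))"
  have "(t *\<^sub>R p + q) * (t *\<^sub>R p + q) = t\<^sup>2 *\<^sub>R (p * p) + (2 * t) *\<^sub>R (p * q) + q * q"
    by (simp add: algebra_simps power2_eq_square scaleR_2 flip: scaleR_scaleR)
  then have "pair s ((t *\<^sub>R p + q) * (t *\<^sub>R p + q)) = 2 * t * pair s (p * q) + pair s (q * q)"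
    using assms by (simp add: pair_add pair_scale)
  also have "\<dots> = -1" using q by (simp add: t_def field_simps)
  finally show False using psd[of "t *\<^sub>R p + q"] by linarith
qed

text \<open>Positivity makes the annihilator a real radical ideal: a quadratic factor without real roots
  can be cancelled, and a repeated linear factor can be reduced to a simple one.\<close>

lemma annih_real_split:
  assumes "f \<noteq> 0" "ueval f x * y \<in> annih s"
  shows "\<exists>A. finite A \<and> (\<Prod>a\<in>A. x - of_real a) * y \<in> annih s"
  using assms
\<comment> \<open>Generalising over \<open>y\<close> lets it absorb the linear factors split off
  from \<open>f\<close>.\<close>
proof (induction "degree f" arbitrary: f y rule: less_induct)
  case less
  show ?case
  proof (cases "degree f = 0")
    case True
    then obtain c where c: "f = [:c:]" by (metis degree_0_id)
    then have "c \<noteq> 0" "c *\<^sub>R y \<in> annih s" using less by (auto simp: scaleR_conv_of_real)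
    then have "y \<in> annih s" using annih_scale[of "c *\<^sub>R y" s "1 / c"] by simp
    then show ?thesis by (intro exI[of _ "{}"]) simp
  next
    case False
    then have "degree f > 0" by simp
    then show ?thesis
    proof (cases rule: real_poly_factor_cases)
      case (linear a g)
      have g: "g \<noteq> 0" using less(2) linear by auto
      then have deg: "degree g < degree f" unfolding linear by (subst degree_mult_eq) auto
      have "ueval g x * ((x - of_real a) * y) \<in> annih s"
        using less(3) unfolding linear ueval_mult by (simp add: algebra_simps)
      then obtain A where A: "finite A" "(\<Prod>a\<in>A. x - of_real a) * ((x - of_real a) * y) \<in> annih s"
        using less(1)[OF deg g] by blast
      show ?thesis
      proof (cases "a \<in> A")
        case False
        then show ?thesis using A by (intro exI[of _ "insert a A"]) (simp add: mult_ac)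
      next
        case True
        define w where "w = (\<Prod>a\<in>A. x - of_real a) * y"
        have "w * w = (\<Prod>a\<in>A - {a}. x - of_real a) * y
            * ((\<Prod>a\<in>A. x - of_real a) * ((x - of_real a) * y))"
          using A(1) True by (simp add: w_def prod.remove mult_ac)
        then have "w * w \<in> annih s" using annih_mult[OF A(2)] by simp
        then show ?thesis using A(1) square_annih[OF pair_annih] unfolding w_def by blast
      qed
    next
      case (quadratic a b g)
      let ?q = "[:-a, 1:]^2 + [:b^2:]"
      have "coeff ?q 2 = 1" by (simp add: power2_eq_square numeral_2_eq_2)
      moreover have "degree ?q = 2" by (simp add: power2_eq_square)
      ultimately have g: "g \<noteq> 0" "degree g < degree f"
        using less(2) by (auto simp: quadratic(2) degree_mult_eq)
      define z where "z = ueval g x * y"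
      have "ueval f x * y = ((x - of_real a)^2 + of_real (b^2)) * z"
        unfolding quadratic(2) ueval_mult ueval_add z_def power2_eq_square
        by (simp add: algebra_simps)
      \<comment> \<open>A further factor \<open>z\<close> turns the relation into a sum of two
        squares, so both terms have pairing zero.\<close>
      then have "z * (((x - of_real a)^2 + of_real (b^2)) * z) \<in> annih s"
        using less(3) annih_mult by metis
      moreover have "z * (((x - of_real a)^2 + of_real (b^2)) * z)
          = ((x - of_real a) * z) * ((x - of_real a) * z) + b^2 *\<^sub>R (z * z)"
        by (simp add: power2_eq_square algebra_simps scaleR_conv_of_real)
      ultimately have "pair s (((x - of_real a) * z) * ((x - of_real a) * z)) + b^2 * pair s (z * z) = 0"
        using pair_annih by (metis pair_add pair_scale real_scaleR_def)
      then have "b^2 * pair s (z * z) = 0"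
        using psd[of "(x - of_real a) * z"] psd[of z]
        by (metis add_nonneg_eq_0_iff mult_nonneg_nonneg zero_le_power2)
      then have "z \<in> annih s" using quadratic(1) by (intro square_annih) simp
      then show ?thesis using less(1)[OF g(2,1)] z_def by blast
    qed
  qed
qed

text \<open>The \<open>r + 1\<close> powers of \<open>x\<close> up to \<open>x ^ r\<close> have
  linearly dependent images under a Hankel operator of rank \<open>r\<close>.\<close>

lemma annih_univariate:
  obtains f where "f \<noteq> 0" "ueval f x \<in> annih s"
proof -
  have "has_dim (range (\<lambda>p. star p s)) r" using rank by (simp add: rankH_eq_def)
  then obtain c where c: "\<exists>i\<le>r. c i \<noteq> 0" "(\<Sum>i\<le>r. fscale (c i) (star (x ^ i) s)) = 0"
    using has_dim_imp_dependency[where v = "\<lambda>i. star (x ^ i) s"] by blast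
  define f where "f = (\<Sum>i\<le>r. monom (c i) i)"
  have "coeff f i = c i" if "i \<le> r" for i
    using that by (simp add: f_def coeff_sum sum.delta)
  then have "f \<noteq> 0" using c(1) by auto
  moreover have "pair s (ueval f x * q) = 0" for q
  proof -
    have "pair s (ueval f x * q) = (\<Sum>i\<le>r. c i * pair s (x ^ i * q))"
      by (simp add: f_def ueval_sum ueval_monom sum_distrib_right pair_sum mult.assoc pair_scale
          flip: scaleR_conv_of_real)
    also have "\<dots> = pair (\<Sum>i\<le>r. fscale (c i) (star (x ^ i) s)) q"
      by (simp add: pair_sum_left pair_fscale pair_star)
    also have "\<dots> = 0" by (simp add: c(2) pair_def)
    finally show ?thesis .
  qed
  ultimately show ?thesis using that by (auto simp: annih_def)
qed

lemma annih_split_var: "\<exists>A. finite A \<and> A \<noteq> {} \<and> (\<Prod>a\<in>A. x - of_real a) \<in> annih s"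
proof -
  obtain f where "f \<noteq> 0" "ueval f x \<in> annih s" by (rule annih_univariate)
  then obtain A where A: "finite A" "(\<Prod>a\<in>A. x - of_real a) \<in> annih s"
    using annih_real_split[of f x 1] by auto
  show ?thesis
  proof (cases "A = {}")
    \<comment> \<open>The empty product puts \<open>1\<close> into the ideal. Any nonempty set then
      works, and nonemptiness is what makes Lagrange polynomials sum to \<open>1\<close>.\<close>
    case True
    then have "x * 1 \<in> annih s" using A(2) by (intro annih_mult) simp
    then show ?thesis by (intro exI[of _ "{0}"]) simp
  qed (use A in blast)
qed

lemma atomic_representation:
  obtains \<omega> :: "nat \<Rightarrow> real" and \<xi> :: "nat \<Rightarrow> 'n \<Rightarrow> real"
  where "\<And>i. i < r \<Longrightarrow> \<omega> i > 0" "s = (\<lambda>\<alpha>. \<Sum>i<r. \<omega> i * expser (\<xi> i) \<alpha>)"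
proof -
  have "\<forall>j. \<exists>A. finite A \<and> A \<noteq> {} \<and> (\<Prod>a\<in>A. xvar j - of_real a) \<in> annih s"
    using annih_split_var by blast
  then obtain A where A: "\<And>j. finite (A j)" "\<And>j. A j \<noteq> {}"
      "\<And>j. (\<Prod>a\<in>A j. xvar j - of_real a) \<in> annih s"
    by metis
  \<comment> \<open>The grid of candidate points, one root chosen for each variable; some of them
    may get weight zero.\<close>
  define Z where "Z = PiE UNIV A"
  have finZ: "finite Z" using A(1) by (simp add: Z_def finite_PiE)
  have Z_A: "\<xi> j \<in> A j" if "\<xi> \<in> Z" for \<xi> j using that by (auto simp: Z_def)
  define L where "L \<xi> = (\<Prod>j\<in>UNIV. ueval (lagrange (A j) (\<xi> j)) (xvar j))" for \<xi>
  have sum_L: "(\<Sum>\<xi>\<in>Z. L \<xi>) = 1"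
  proof -
    have "(\<Sum>\<xi>\<in>Z. L \<xi>) = (\<Prod>j\<in>UNIV. \<Sum>a\<in>A j. ueval (lagrange (A j) a) (xvar j))"
      unfolding L_def Z_def using A(1) by (subst prod_sum_PiE) auto
    also have "\<dots> = 1" by (simp add: A sum_lagrange flip: ueval_sum)
    finally show ?thesis .
  qed
  have eval_L: "pair (expser \<eta>) (L \<xi>) = (if \<eta> = \<xi> then 1 else 0)" if "\<eta> \<in> Z" for \<eta> \<xi>
  proof -
    have "pair (expser \<eta>) (L \<xi>) = (\<Prod>j\<in>UNIV. if \<eta> j = \<xi> j then 1 else 0)"
      using that by (simp add: L_def pair_expser_prod pair_expser_ueval poly_lagrange A Z_A)
    also have "\<dots> = (if \<eta> = \<xi> then 1 else 0)" by (auto simp: fun_eq_iff)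
    finally show ?thesis .
  qed
  have xvar_L: "xvar j * L \<xi> - \<xi> j *\<^sub>R L \<xi> \<in> annih s" if "\<xi> \<in> Z" for \<xi> j
  proof -
    let ?c = "\<Prod>b\<in>A j - {\<xi> j}. 1 / (\<xi> j - b)"
    let ?R = "\<Prod>i\<in>UNIV - {j}. ueval (lagrange (A i) (\<xi> i)) (xvar i)"
    have "xvar j * L \<xi> - \<xi> j *\<^sub>R L \<xi>
        = ueval ([:- \<xi> j, 1:] * lagrange (A j) (\<xi> j)) (xvar j) * ?R"
      unfolding ueval_mult L_def prod.remove[OF finite UNIV_I, of _ j]
      by (simp add: algebra_simps scaleR_conv_of_real)
    also have "\<dots> = of_real ?c * ?R * (\<Prod>a\<in>A j. xvar j - of_real a)"
      using linear_factor_mult_lagrange[OF A(1) Z_A[OF that], of j]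
      by (simp add: ueval_smult ueval_prod mult_ac)
    also have "\<dots> \<in> annih s" using A(3) by (rule annih_mult)
    finally show ?thesis .
  qed
  \<comment> \<open>Modulo the annihilator \<open>L \<xi>\<close> is a common eigenvector of the
    variables, hence of every \<open>p\<close>, with eigenvalue the value of \<open>p\<close> at
    \<open>\<xi>\<close>.\<close>
  have mult_L: "p * L \<xi> - pair (expser \<xi>) p *\<^sub>R L \<xi> \<in> annih s" if "\<xi> \<in> Z" for p \<xi>
  proof (induction p rule: rpoly_induct)
    case one
    then show ?case by (simp add: subspace_0[OF subspace_annih])
  next
    case (add p q)
    then show ?case using annih_add[OF add] by (simp add: pair_add algebra_simps)
  next
    case (scale c p)
    then show ?case using annih_scale[OF scale, of c] by (simp add: pair_scale algebra_simps)
  next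
    case (var j p)
    have "xvar j * (p * L \<xi> - pair (expser \<xi>) p *\<^sub>R L \<xi>)
        + pair (expser \<xi>) p *\<^sub>R (xvar j * L \<xi> - \<xi> j *\<^sub>R L \<xi>) \<in> annih s"
      by (intro annih_add annih_mult[OF var] annih_scale xvar_L that)
    then show ?case unfolding pair_expser_xvar by (simp add: algebra_simps)
  qed
  define w where "w \<xi> = pair s (L \<xi>)" for \<xi>
  have pair_mult_L: "pair s (p * L \<xi>) = pair (expser \<xi>) p * w \<xi>" if "\<xi> \<in> Z" for p \<xi>
    using pair_annih[OF mult_L[OF that, of p]] by (simp add: pair_diff pair_scale w_def)
  \<comment> \<open>The value of \<open>L \<xi>\<close> at \<open>\<xi>\<close> is 1, so the weight
    is the pairing of \<open>s\<close> with the square of \<open>L \<xi>\<close>.\<close>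
  have w_nonneg: "w \<xi> \<ge> 0" if "\<xi> \<in> Z" for \<xi>
    using psd[of "L \<xi>"] pair_mult_L[OF that, of "L \<xi>"] that by (simp add: eval_L)
  \<comment> \<open>Only points of positive weight contribute to the rank.\<close>
  define P where "P = {\<xi> \<in> Z. w \<xi> > 0}"
  have finP: "finite P" and PZ: "\<And>\<xi>. \<xi> \<in> P \<Longrightarrow> \<xi> \<in> Z" using finZ by (auto simp: P_def)
  have pair_s: "pair s p = (\<Sum>\<xi>\<in>P. w \<xi> * pair (expser \<xi>) p)" for p
  proof -
    have "pair s p = pair s (p * (\<Sum>\<xi>\<in>Z. L \<xi>))" by (simp add: sum_L)
    also have "\<dots> = (\<Sum>\<xi>\<in>Z. w \<xi> * pair (expser \<xi>) p)"
      by (simp add: sum_distrib_left pair_sum pair_mult_L mult.commute)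
    also have "\<dots> = (\<Sum>\<xi>\<in>P. w \<xi> * pair (expser \<xi>) p)"
      using finZ w_nonneg by (intro sum.mono_neutral_right) (force simp: P_def)+
    finally show ?thesis .
  qed
  have star_s: "star p s = (\<Sum>\<xi>\<in>P. fscale (w \<xi> * pair (expser \<xi>) p) (expser \<xi>))" for p
    by (rule rseries_eqI) (simp add: pair_star pair_s pair_sum_left pair_fscale pair_expser_mult mult_ac)
  have inj: "inj_on expser P"
  proof (rule inj_onI)
    fix \<xi> \<eta> assume "\<xi> \<in> P" "\<eta> \<in> P" "expser \<xi> = expser \<eta>"
    then have "pair (expser \<xi>) (L \<eta>) = 1" using eval_L[of \<eta> \<eta>] PZ by simp
    then show "\<xi> = \<eta>" using eval_L[OF PZ[OF \<open>\<xi> \<in> P\<close>], of \<eta>] by (metis zero_neq_one)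
  qed
  have "has_dim (range (\<lambda>p. star p s)) (card P)"
    unfolding has_dim_def
  proof (intro exI[of _ "expser ` P"] conjI)
    show "finite (expser ` P)" "card (expser ` P) = card P"
      using finP inj by (simp_all add: card_image)
    show "\<not> fs.dependent (expser ` P)"
    proof
      assume "fs.dependent (expser ` P)"
      then obtain u \<eta> where u: "\<eta> \<in> P" "u (expser \<eta>) \<noteq> 0"
          "(\<Sum>v\<in>expser ` P. fscale (u v) v) = 0"
        using fs.dependent_finite[of "expser ` P"] finP by auto
      have "0 = pair (\<Sum>v\<in>expser ` P. fscale (u v) v) (L \<eta>)" by (simp add: u(3) pair_def)
      also have "\<dots> = (\<Sum>\<xi>\<in>P. u (expser \<xi>) * pair (expser \<xi>) (L \<eta>))"
        by (simp add: sum.reindex[OF inj] pair_sum_left pair_fscale)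
      also have "\<dots> = (\<Sum>\<xi>\<in>P. if \<xi> = \<eta> then u (expser \<xi>) else 0)"
        by (intro sum.cong) (auto simp: eval_L PZ)
      also have "\<dots> = u (expser \<eta>)" using finP u(1) by (simp add: sum.delta)
      finally show False using u(2) by simp
    qed
    \<comment> \<open>Acting with \<open>L \<eta>\<close> isolates the term at
      \<open>\<eta>\<close>, and dividing by the nonzero weight normalises it.\<close>
    have "expser \<eta> = star ((1 / w \<eta>) *\<^sub>R L \<eta>) s" if "\<eta> \<in> P" for \<eta>
    proof -
      have "w \<eta> \<noteq> 0" using that by (simp add: P_def)
      have "star ((1 / w \<eta>) *\<^sub>R L \<eta>) s = (\<Sum>\<xi>\<in>P. if \<xi> = \<eta> then expser \<xi> else 0)"
        unfolding star_s using \<open>w \<eta> \<noteq> 0\<close>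
        by (intro sum.cong) (auto simp: pair_scale eval_L PZ)
      then show ?thesis using finP that by (simp add: sum.delta)
    qed
    then have "expser ` P \<subseteq> range (\<lambda>p. star p s)" by blast
    moreover have "fs.subspace (range (\<lambda>p. star p s))"
    proof (rule fs.subspaceI)
      have "star 0 s = 0" using star_scale[of 0 0 s] by simp
      then show "0 \<in> range (\<lambda>p. star p s)" by (metis rangeI)
    qed (auto simp: star_add[symmetric] star_scale[symmetric])
    ultimately have "fs.span (expser ` P) \<subseteq> range (\<lambda>p. star p s)" by (rule fs.span_minimal)
    moreover have "star p s \<in> fs.span (expser ` P)" for p
      unfolding star_s by (intro fs.span_sum fs.span_scale fs.span_base) auto
    ultimately show "fs.span (expser ` P) = range (\<lambda>p. star p s)" by blast
  qed
  then have "card P = r" using rank has_dim_unique by (auto simp: rankH_eq_def)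
  then obtain h where h: "bij_betw h {..<r} P"
    using ex_bij_betw_nat_finite[OF finP] by (auto simp: atLeast0LessThan)
  have "s = (\<Sum>\<xi>\<in>P. fscale (w \<xi>) (expser \<xi>))"
    by (rule rseries_eqI) (simp add: pair_s pair_sum_left pair_fscale)
  then have "s = (\<lambda>\<alpha>. \<Sum>i<r. w (h i) * expser (h i) \<alpha>)"
    by (simp add: fun_eq_iff sum_fun_apply sum.reindex_bij_betw[OF h, symmetric])
  moreover have "w (h i) > 0" if "i < r" for i
    using bij_betwE[OF h] that by (auto simp: P_def)
  ultimately show ?thesis using that[of "\<lambda>i. w (h i)" h] by blast
qed

end

text \<open>If \<open>p\<close> reduces to \<open>u\<close> in \<open>U\<close> modulo the ideal
  \<open>annih s\<close>, then the squares of \<open>p\<close> and \<open>u\<close> also agree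
  modulo it, and on \<open>u * u\<close> the series agrees with \<open>\<sigma>\<close>.\<close>

lemma (in flat_form) flat_extension_psd:
  assumes "extends s" "rankH_eq s r" and pos: "\<And>p. p \<in> V \<Longrightarrow> \<sigma> (p * p) \<ge> 0"
  shows "pair s (p * p) \<ge> 0"
proof -
  have "\<exists>u\<in>U. p - u \<in> annih s"
    using kerV_sub_annih[OF assms(1,2)] annih_mult by (intro U_complements_ideal subspace_annih)
  then obtain u where u: "u \<in> U" "p - u \<in> annih s" by blast
  have "p * p - u * u = (p + u) * (p - u)" by (simp add: algebra_simps)
  then have "pair s (p * p - u * u) = 0" using annih_mult[OF u(2)] pair_annih by metis
  then have "pair s (p * p) = pair s (u * u)" by (simp add: pair_diff)
  also have "\<dots> = \<sigma> (u * u)" using extends_mult[OF assms(1)] u(1) U_V by blast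
  finally show ?thesis using pos u(1) U_V by simp
qed

theorem theorem4:
  fixes V U :: "'n::finite rpoly set"
    and \<sigma> :: "'n rpoly \<Rightarrow> real"
    and r :: nat
  assumes "subspace V" and "connected_to_one V"
    and "\<forall>a\<in>prodspan V. \<forall>b\<in>prodspan V. \<sigma> (a + b) = \<sigma> a + \<sigma> b"
    and "\<forall>c. \<forall>a\<in>prodspan V. \<sigma> (c *\<^sub>R a) = c * \<sigma> a"
    and "subspace U" and "U \<subseteq> V" and "1 \<in> U" and "vplus U \<subseteq> V"
    and "rankHWW_eq \<sigma> V r" and "rankHWW_eq \<sigma> U r"
    and "\<forall>p\<in>V. \<sigma> (p * p) \<ge> 0"
  shows "(\<exists>!s. (\<forall>q\<in>prodspan V. pair s q = \<sigma> q) \<and> rankH_eq s r) \<and>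
         (\<forall>s. (\<forall>q\<in>prodspan V. pair s q = \<sigma> q) \<and> rankH_eq s r \<longrightarrow>
            (\<exists>(\<omega>::nat \<Rightarrow> real) (\<xi>::nat \<Rightarrow> 'n \<Rightarrow> real).
               (\<forall>i<r. \<omega> i > 0) \<and>
               s = (\<lambda>\<alpha>. \<Sum>i<r. \<omega> i * expser (\<xi> i) \<alpha>)))"
proof -
  interpret flat_form V U \<sigma> r
    using assms by unfold_locales auto
  have "\<exists>!s. extends s \<and> rankH_eq s r"
    using flat_extension_exists flat_extension_unique by blast
  moreover have "\<exists>(\<omega>::nat \<Rightarrow> real) (\<xi>::nat \<Rightarrow> 'n \<Rightarrow> real). (\<forall>i<r. \<omega> i > 0) \<and>
      s = (\<lambda>\<alpha>. \<Sum>i<r. \<omega> i * expser (\<xi> i) \<alpha>)" if "extends s" "rankH_eq s r" for s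
  proof -
    interpret psd_finite_rank s r
      using flat_extension_psd[OF that] assms(11) that(2) by unfold_locales auto
    show ?thesis using atomic_representation by metis
  qed
  ultimately show ?thesis unfolding extends_def by blast
qed

end
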